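(* Let $M$ be a matroid on a finite linearly ordered set $E$, and let $p,q$ be non-negative integers. Then $$\frac{\partial^{p+q} t}{\partial x^p\,\partial y^q}(M;x,y)=p!\,q!\sum_{\substack{A\subseteq E\\ cr_M(A)=p,\ nl_M(A)=q}} x^{\iota_M(A)}\,y^{\epsilon_M(A)}.$$
   Context: $r_M$ is the rank function of $M$ and $r(M)=r_M(E)$. The Tutte polynomial is $t(M;x,y)=\sum_{A\subseteq E}(x-1)^{r(M)-r_M(A)}(y-1)^{|A|-r_M(A)}$. For $A\subseteq E$: the corank is $cr_M(A)=r(M)-r_M(A)$ and the nullity is $nl_M(A)=|A|-r_M(A)$. $\mathrm{Ext}_M(A)$ is the set of $e\in E\setminus A$ such that $e$ is the smallest element (in the linear order) of some circuit of $M$ contained in $A\cup\{e\}$, and $\epsilon_M(A)=|\mathrm{Ext}_M(A)|$ (external activity). $\mathrm{Int}_M(A)$ is the set of $e\in A$ such that $e$ is the smallest element of some cocircuit of $M$ contained in $(E\setminus A)\cup\{e\}$, and $\iota_M(A)=|\mathrm{Int}_M(A)|$ (internal activity). *)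

theory Defs
  imports "HOL-Computational_Algebra.Polynomial"
begin

locale matroid =
  fixes E :: "'a set" and indep :: "'a set \<Rightarrow> bool"
  assumes finite_ground: "finite E"
    and indep_subset_ground: "indep X \<Longrightarrow> X \<subseteq> E"
    and indep_empty: "indep {}"
    and indep_subset: "indep X \<Longrightarrow> Y \<subseteq> X \<Longrightarrow> indep Y"
    and augment: "indep X \<Longrightarrow> indep Y \<Longrightarrow> card X < card Y \<Longrightarrow> \<exists>e\<in>Y - X. indep (insert e X)"

definition rank :: "('a set \<Rightarrow> bool) \<Rightarrow> 'a set \<Rightarrow> nat" where
  "rank indep A = Max (card ` {X. X \<subseteq> A \<and> indep X})"

definition basis :: "('a set \<Rightarrow> bool) \<Rightarrow> 'a set \<Rightarrow> bool" where
  "basis indep B \<longleftrightarrow> indep B \<and> (\<forall>X. indep X \<and> B \<subseteq> X \<longrightarrow> X = B)"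

definition circuit :: "'a set \<Rightarrow> ('a set \<Rightarrow> bool) \<Rightarrow> 'a set \<Rightarrow> bool" where
  "circuit E indep C \<longleftrightarrow> C \<subseteq> E \<and> \<not> indep C \<and> (\<forall>D. D \<subset> C \<longrightarrow> indep D)"

text \<open>Independence in the dual matroid, whose bases are the complements of the bases.\<close>

definition dual_indep :: "'a set \<Rightarrow> ('a set \<Rightarrow> bool) \<Rightarrow> 'a set \<Rightarrow> bool" where
  "dual_indep E indep X \<longleftrightarrow> (\<exists>B. basis indep B \<and> X \<subseteq> E - B)"

definition cocircuit :: "'a set \<Rightarrow> ('a set \<Rightarrow> bool) \<Rightarrow> 'a set \<Rightarrow> bool" where
  "cocircuit E indep = circuit E (dual_indep E indep)"

text \<open>The natural-number subtractions below never truncate for a matroid and \<open>A \<subseteq> E\<close>.\<close>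

definition corank :: "'a set \<Rightarrow> ('a set \<Rightarrow> bool) \<Rightarrow> 'a set \<Rightarrow> nat" where
  "corank E indep A = rank indep E - rank indep A"

definition nullity :: "('a set \<Rightarrow> bool) \<Rightarrow> 'a set \<Rightarrow> nat" where
  "nullity indep A = card A - rank indep A"

definition smallest_in :: "'a::linorder \<Rightarrow> 'a set \<Rightarrow> bool" where
  "smallest_in e C \<longleftrightarrow> e \<in> C \<and> (\<forall>c\<in>C. e \<le> c)"

definition Ext :: "'a::linorder set \<Rightarrow> ('a set \<Rightarrow> bool) \<Rightarrow> 'a set \<Rightarrow> 'a set" where
  "Ext E indep A = {e \<in> E - A. \<exists>C. circuit E indep C \<and> C \<subseteq> A \<union> {e} \<and> smallest_in e C}"

definition Int_act :: "'a::linorder set \<Rightarrow> ('a set \<Rightarrow> bool) \<Rightarrow> 'a set \<Rightarrow> 'a set" where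
  "Int_act E indep A =
    {e \<in> A. \<exists>C. cocircuit E indep C \<and> C \<subseteq> (E - A) \<union> {e} \<and> smallest_in e C}"

definition ext_activity :: "'a::linorder set \<Rightarrow> ('a set \<Rightarrow> bool) \<Rightarrow> 'a set \<Rightarrow> nat" where
  "ext_activity E indep A = card (Ext E indep A)"

definition int_activity :: "'a::linorder set \<Rightarrow> ('a set \<Rightarrow> bool) \<Rightarrow> 'a set \<Rightarrow> nat" where
  "int_activity E indep A = card (Int_act E indep A)"

text \<open>
  The ring \<open>\<int>[x,y]\<close> is represented as \<open>\<int>[x][y]\<close>: the outer polynomial variable is \<open>y\<close> and the
  coefficients are polynomials in \<open>x\<close>. So \<open>\<partial>/\<partial>y\<close> is the derivative of the outer polynomial and
  \<open>\<partial>/\<partial>x\<close> differentiates each coefficient.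
\<close>

type_synonym bipoly = "int poly poly"

definition var_x :: bipoly where "var_x = [:[:0, 1:]:]"

definition var_y :: bipoly where "var_y = [:0, 1:]"

definition partial_x :: "bipoly \<Rightarrow> bipoly" where "partial_x = map_poly pderiv"

definition partial_y :: "bipoly \<Rightarrow> bipoly" where "partial_y = pderiv"

definition tutte :: "'a set \<Rightarrow> ('a set \<Rightarrow> bool) \<Rightarrow> bipoly" where
  "tutte E indep =
    (\<Sum>A\<in>Pow E. (var_x - 1) ^ corank E indep A * (var_y - 1) ^ nullity indep A)"

end

theory Submission imports Defs begin

text \<open>
  Reveal the elements of \<open>E\<close> from the largest to the smallest, deleting those outside \<open>A\<close> and
  contracting those in \<open>A\<close>. Whether the element \<open>e\<close> is a loop or a coloop of the minor reached just
  before \<open>e\<close> depends only on the part of \<open>A\<close> above \<open>e\<close>. The external activity and the nullity of \<open>A\<close>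
  count the loops outside and inside \<open>A\<close>, the corank and the internal activity count the coloops
  outside and inside \<open>A\<close>.

  Since deleting and contracting a loop or a coloop give the same minor, deletion-contraction shows
  that the sum of \<open>x^\<iota> y^\<epsilon> u^cr v^nl\<close> over all \<open>A\<close> depends only on \<open>x + u\<close> and \<open>y + v\<close>. Hence it is
  unchanged when \<open>(x, y, u, v)\<close> is replaced by \<open>(1, 1, u + x - 1, v + y - 1)\<close>, which is the Taylor
  expansion of the Tutte polynomial; now compare the coefficients of \<open>u^p v^q\<close>.
\<close>

section \<open>Rank\<close>

context matroid
begin

abbreviation r :: "'a set \<Rightarrow> nat" where "r \<equiv> rank indep"

lemma finite_indep: "indep X \<Longrightarrow> finite X"
  using finite_ground finite_subset indep_subset_ground by blast

lemma finite_indep_sets: "finite {X. X \<subseteq> A \<and> indep X}"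
  by (rule finite_subset[of _ "Pow E"]) (use finite_ground indep_subset_ground in auto)

lemma card_le_rank: "indep X \<Longrightarrow> X \<subseteq> A \<Longrightarrow> card X \<le> r A"
  unfolding rank_def by (rule Max_ge) (use finite_indep_sets in auto)

lemma rank_attained:
  obtains X where "X \<subseteq> A" "indep X" "card X = r A"
proof -
  have "r A \<in> card ` {X. X \<subseteq> A \<and> indep X}"
    unfolding rank_def by (rule Max_in) (use finite_indep_sets indep_empty in auto)
  with that show ?thesis by auto
qed

lemma rank_mono: "A \<subseteq> B \<Longrightarrow> r A \<le> r B"
  by (metis rank_attained card_le_rank order_trans)

lemma rank_le_card: "finite A \<Longrightarrow> r A \<le> card A"
  by (metis card_mono rank_attained)

lemma rank_indep: "indep X \<Longrightarrow> r X = card X"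
  by (simp add: card_le_rank finite_indep le_antisym rank_le_card)

lemma indep_iff_rank: "X \<subseteq> E \<Longrightarrow> indep X \<longleftrightarrow> r X = card X"
  by (metis card_subset_eq finite_ground finite_subset rank_attained rank_indep)

lemma rank_empty: "r {} = 0"
  by (simp add: indep_empty rank_indep)

lemma rank_insert_le: "r (insert e A) \<le> Suc (r A)"
proof -
  obtain X where X: "X \<subseteq> insert e A" "indep X" "card X = r (insert e A)"
    by (rule rank_attained)
  have "card (X - {e}) \<le> r A"
    using X by (intro card_le_rank indep_subset[OF X(2)]) auto
  moreover have "card X \<le> Suc (card (X - {e}))"
    by (metis card.insert_remove card_mono finite_indep X(2) finite.insertI finite_Diff insert_Diff_single subset_insertI)
  ultimately show ?thesis using X by linarith
qed

lemma rank_insert_cases: "r (insert e A) = r A \<or> r (insert e A) = Suc (r A)"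
  using rank_insert_le[of e A] rank_mono[OF subset_insertI, of A e] by linarith

text \<open>A maximal independent set between \<open>I\<close> and \<open>A\<close> has size
  \<open>r A\<close>, since otherwise \<open>augment\<close> would enlarge it inside
  \<open>A\<close>.\<close>

lemma indep_extend:
  assumes "indep I" "I \<subseteq> A"
  obtains J where "I \<subseteq> J" "J \<subseteq> A" "indep J" "card J = r A"
proof -
  let ?S = "{J. J \<subseteq> A \<and> indep J \<and> I \<subseteq> J}"
  have "finite ?S"
    by (rule finite_subset[OF _ finite_indep_sets[of A]]) auto
  moreover have "?S \<noteq> {}" using assms by auto
  ultimately obtain J where J: "J \<in> ?S" and max: "\<forall>J'\<in>?S. J \<subseteq> J' \<longrightarrow> J = J'"
    by (rule bexE[OF finite_has_maximal])
  have "card J = r A"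
  proof (rule ccontr)
    assume "card J \<noteq> r A"
    with J(1) have less: "card J < r A" using card_le_rank[of J A] by auto
    obtain Y where Y: "Y \<subseteq> A" "indep Y" "card Y = r A" by (rule rank_attained)
    with less J(1) obtain e where "e \<in> Y - J" "indep (insert e J)"
      using augment[of J Y] by auto
    then show False using bspec[OF max, of "insert e J"] J Y by auto
  qed
  with J that show ?thesis by auto
qed

text \<open>This is monotonicity of closure. A basis of \<open>A\<close> extends to one of
  \<open>B\<close>; if \<open>e\<close> could be added to the larger basis, it could be added to the
  smaller one.\<close>

lemma rank_insert_eq_superset:
  assumes eq: "r (insert e A) = r A" and "A \<subseteq> B"
  shows "r (insert e B) = r B"
proof (rule ccontr)
  assume ne: "r (insert e B) \<noteq> r B"
  obtain I where I: "I \<subseteq> A" "indep I" "card I = r A" by (rule rank_attained)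
  obtain J where J: "I \<subseteq> J" "J \<subseteq> B" "indep J" "card J = r B"
    using indep_extend[of I B] I assms(2) by auto
  obtain Y where Y: "Y \<subseteq> insert e B" "indep Y" "card Y = r (insert e B)" by (rule rank_attained)
  have "card J < card Y" using ne rank_insert_cases[of e B] J Y by auto
  then obtain f where f: "f \<in> Y - J" "indep (insert f J)" using augment[of J Y] J Y by auto
  have card: "card (insert f J) = Suc (r B)" using f J finite_indep by simp
  \<comment> \<open>\<open>J\<close> already has the largest size possible inside \<open>B\<close>,
    so the augmenting element can only be \<open>e\<close>.\<close>
  have "f \<notin> B" using card_le_rank[OF f(2), of B] card J by auto
  then have [simp]: "f = e" using f Y by auto
  have "e \<notin> I" using f J by auto
  then have "card (insert e I) = Suc (r A)" using I finite_indep by simp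
  moreover have "indep (insert e I)" using f(2) by (rule indep_subset) (use J in auto)
  ultimately show False using card_le_rank[of "insert e I" "insert e A"] I eq by auto
qed

lemma rank_less_insert:
  assumes "r A < r B" "A \<subseteq> B"
  obtains f where "f \<in> B" "r (insert f A) = Suc (r A)"
proof -
  obtain I where I: "I \<subseteq> A" "indep I" "card I = r A" by (rule rank_attained)
  obtain J where J: "J \<subseteq> B" "indep J" "card J = r B" by (rule rank_attained)
  obtain f where f: "f \<in> J - I" "indep (insert f I)"
    using augment[of I J] I J assms by auto
  have "Suc (r A) \<le> r (insert f A)"
    using card_le_rank[OF f(2), of "insert f A"] I f finite_indep by auto
  with rank_insert_le[of f A] J f that show ?thesis by (metis DiffE le_antisym subsetD)
qed

section \<open>Circuits and cocircuits in terms of rank\<close>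

lemma circuit_through_iff_rank:
  assumes "e \<in> E" "e \<notin> D" "D \<subseteq> E"
  shows "(\<exists>C. circuit E indep C \<and> C \<subseteq> insert e D \<and> e \<in> C) \<longleftrightarrow> r (insert e D) = r D"
proof
  assume "\<exists>C. circuit E indep C \<and> C \<subseteq> insert e D \<and> e \<in> C"
  then obtain C where C: "circuit E indep C" "C \<subseteq> insert e D" "e \<in> C" by auto
  then have dep: "\<not> indep C" "C \<subseteq> E" and ind: "indep (C - {e})"
    unfolding circuit_def by auto
  have "r C \<noteq> card C" "r C \<le> card C"
    using dep indep_iff_rank rank_le_card finite_subset finite_ground by metis+
  then have "r C \<le> r (C - {e})"
    using rank_indep[OF ind] C by simp
  with rank_mono[of "C - {e}" C] C(3) have "r (insert e (C - {e})) = r (C - {e})"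
    by (auto simp: insert_absorb)
  then show "r (insert e D) = r D"
    by (rule rank_insert_eq_superset) (use C in auto)
next
  assume eq: "r (insert e D) = r D"
  obtain I where I: "I \<subseteq> D" "indep I" "card I = r D" by (rule rank_attained)
  have "\<not> indep (insert e I)"
  proof
    assume "indep (insert e I)"
    then have "card (insert e I) \<le> r (insert e D)" by (rule card_le_rank) (use I in auto)
    moreover have "card (insert e I) = Suc (card I)"
      using I assms finite_indep[of I] by (intro card_insert_disjoint) auto
    ultimately show False using I eq by simp
  qed
  \<comment> \<open>A minimal dependent subset of \<open>insert e I\<close> is a circuit, and it
    contains \<open>e\<close> because \<open>I\<close> is independent.\<close>
  then have "insert e I \<in> {C. C \<subseteq> insert e I \<and> \<not> indep C}" by auto
  moreover have "finite {C. C \<subseteq> insert e I \<and> \<not> indep C}"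
    using finite_indep[of I] I by (auto intro!: finite_subset[of _ "Pow (insert e I)"])
  ultimately obtain C where C: "C \<in> {C. C \<subseteq> insert e I \<and> \<not> indep C}"
      and min: "\<forall>D\<in>{C. C \<subseteq> insert e I \<and> \<not> indep C}. D \<subseteq> C \<longrightarrow> C = D"
    by (metis (no_types, lifting) finite_has_minimal empty_iff)
  have "circuit E indep C"
    unfolding circuit_def
  proof (intro conjI allI impI)
    show "C \<subseteq> E" using C I assms by auto
    show "\<not> indep C" using C by simp
    show "indep D'" if "D' \<subset> C" for D'
    proof (rule ccontr)
      assume "\<not> indep D'"
      with that C have "D' \<in> {C. C \<subseteq> insert e I \<and> \<not> indep C}" by auto
      with min that show False by blast
    qed
  qed
  moreover have "e \<in> C"
    using C indep_subset[OF I(2), of C] by auto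
  ultimately show "\<exists>C. circuit E indep C \<and> C \<subseteq> insert e D \<and> e \<in> C"
    using C I by blast
qed

lemma basis_iff_rank: "basis indep B \<longleftrightarrow> indep B \<and> card B = r E"
proof
  assume "basis indep B"
  then have B: "indep B" "\<And>X. indep X \<Longrightarrow> B \<subseteq> X \<Longrightarrow> X = B"
    unfolding basis_def by auto
  obtain J where "B \<subseteq> J" "indep J" "card J = r E"
    using indep_extend[OF B(1) indep_subset_ground[OF B(1)]] by metis
  with B show "indep B \<and> card B = r E" by metis
next
  assume B: "indep B \<and> card B = r E"
  have "X = B" if "indep X" "B \<subseteq> X" for X
    using card_seteq[OF finite_indep[OF that(1)] that(2)]
      card_le_rank[OF that(1) indep_subset_ground[OF that(1)]] B by auto
  with B show "basis indep B" unfolding basis_def by auto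
qed

lemma dual_indep_iff_rank:
  assumes "X \<subseteq> E"
  shows "dual_indep E indep X \<longleftrightarrow> r (E - X) = r E"
proof
  assume "dual_indep E indep X"
  then obtain B where B: "indep B" "card B = r E" "X \<subseteq> E - B"
    unfolding dual_indep_def basis_iff_rank by auto
  have "card B \<le> r (E - X)"
    using B indep_subset_ground[OF B(1)] by (intro card_le_rank) auto
  with B(2) rank_mono[of "E - X" E] show "r (E - X) = r E" by auto
next
  assume eq: "r (E - X) = r E"
  obtain B where "B \<subseteq> E - X" "indep B" "card B = r (E - X)" by (rule rank_attained)
  with eq assms show "dual_indep E indep X"
    unfolding dual_indep_def basis_iff_rank by (intro exI[of _ B]) auto
qed

text \<open>Cocircuits are the complements of hyperplanes, so the question is whether some
  hyperplane contains \<open>Y\<close> and avoids \<open>e\<close>. One does exactly when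
  \<open>e\<close> is outside the closure of \<open>Y\<close>.\<close>

lemma cocircuit_through_iff_rank:
  assumes "e \<in> E" "e \<notin> D" "D \<subseteq> E" and Y: "Y = E - insert e D"
  shows "(\<exists>C. cocircuit E indep C \<and> C \<subseteq> insert e D \<and> e \<in> C) \<longleftrightarrow> r (insert e Y) \<noteq> r Y"
proof
  assume "\<exists>C. cocircuit E indep C \<and> C \<subseteq> insert e D \<and> e \<in> C"
  then obtain C where C: "cocircuit E indep C" "C \<subseteq> insert e D" "e \<in> C" by auto
  then have CE: "C \<subseteq> E" and 1: "\<not> dual_indep E indep C" and 2: "dual_indep E indep (C - {e})"
    unfolding cocircuit_def circuit_def by auto
  have "E - (C - {e}) = insert e (E - C)" using C(3) CE by auto
  with 1 2 have "r (insert e (E - C)) \<noteq> r (E - C)"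
    using dual_indep_iff_rank[of C] dual_indep_iff_rank[of "C - {e}", OF subset_trans[OF Diff_subset CE]] CE
    by simp
  moreover have "Y \<subseteq> E - C" using C Y by auto
  ultimately show "r (insert e Y) \<noteq> r Y" using rank_insert_eq_superset by blast
next
  assume ne: "r (insert e Y) \<noteq> r Y"
  \<comment> \<open>The hyperplane is found as a maximal set above \<open>Y\<close> whose closure
    misses \<open>e\<close>.\<close>
  let ?S = "{X. Y \<subseteq> X \<and> X \<subseteq> E \<and> r (insert e X) \<noteq> r X}"
  have "Y \<in> ?S" using ne Y by auto
  moreover have "finite ?S"
    by (rule finite_subset[of _ "Pow E"]) (use finite_ground in auto)
  ultimately obtain X where X: "X \<in> ?S" and maximal: "\<forall>X'\<in>?S. X \<subseteq> X' \<longrightarrow> X = X'"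
    by (metis (no_types, lifting) finite_has_maximal empty_iff)
  have max: "X = X'" if "X' \<in> ?S" "X \<subseteq> X'" for X'
    using maximal that by simp
  have eX: "e \<notin> X" using X insert_absorb by fastforce
  have rX: "r (insert e X) = Suc (r X)" using X rank_insert_cases by blast
  \<comment> \<open>Otherwise some \<open>f\<close> lifts the rank of \<open>insert e X\<close> to
    \<open>r X + 2\<close>. Then \<open>e\<close> is still outside the closure of
    \<open>insert f X\<close>, against the maximality of \<open>X\<close>.\<close>
  have spanning: "r (insert e X) = r E"
  proof (rule ccontr)
    assume "r (insert e X) \<noteq> r E"
    moreover have "insert e X \<subseteq> E" using X assms by auto
    ultimately obtain f where f: "f \<in> E" "r (insert f (insert e X)) = Suc (r (insert e X))"
      using rank_less_insert[of "insert e X" E] rank_mono[of "insert e X" E] by (metis le_neq_implies_less)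
    then have "r (insert e (insert f X)) \<noteq> r (insert f X)"
      using rX rank_insert_le[of f X] by (simp add: insert_commute)
    then have "X = insert f X" using X f by (intro max) auto
    then have "f \<in> X" by blast
    then have "insert f (insert e X) = insert e X" by blast
    then show False using f by simp
  qed
  have "\<not> dual_indep E indep (E - X)"
    using dual_indep_iff_rank[of "E - X"] X rX spanning by (auto simp: double_diff)
  moreover have "dual_indep E indep D'" if sub: "D' \<subset> E - X" for D'
  proof -
    obtain g where g: "g \<in> E - X" "g \<notin> D'" using sub by blast
    \<comment> \<open>For \<open>g\<close> other than \<open>e\<close>, maximality puts
      \<open>e\<close> in the closure of \<open>insert g X\<close>, so this set has at least the
      rank of the spanning set \<open>insert e X\<close>.\<close>
    have "r (insert g X) = r E"
    proof (cases "g = e")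
      case False
      then have "r (insert e (insert g X)) = r (insert g X)"
        using max[of "insert g X"] X g by auto
      then show ?thesis
        using rank_mono[of "insert e X" "insert e (insert g X)"] rank_mono[of "insert g X" E]
          spanning X g by (auto simp: subset_insertI2)
    qed (use spanning in simp)
    moreover have "insert g X \<subseteq> E - D'" using that g X by auto
    ultimately show ?thesis
      using dual_indep_iff_rank[of D'] rank_mono[of "insert g X" "E - D'"] rank_mono[of "E - D'" E] that
      by auto
  qed
  ultimately have "cocircuit E indep (E - X)"
    unfolding cocircuit_def circuit_def by auto
  then show "\<exists>C. cocircuit E indep C \<and> C \<subseteq> insert e D \<and> e \<in> C"
    using eX assms X by (intro exI[of _ "E - X"]) auto
qed

end

section \<open>Activities\<close>

locale ordered_matroid = matroid E indep
  for E :: "'a::linorder set" and indep :: "'a set \<Rightarrow> bool"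
begin

text \<open>
  Here \<open>F\<close> is the ground set of a minor in which \<open>K\<close> has been contracted, and \<open>X \<subseteq> F\<close> is the set
  of elements still to be contracted.
\<close>

definition loop_at :: "'a set \<Rightarrow> 'a set \<Rightarrow> 'a \<Rightarrow> bool" where
  "loop_at K X e \<longleftrightarrow> r (insert e (K \<union> {a\<in>X. e < a})) = r (K \<union> {a\<in>X. e < a})"

text \<open>The elements of \<open>F\<close> below \<open>e\<close> are still undecided, hence
  present in the minor reached at \<open>e\<close>. A coloop is an element outside the closure of
  all the others, so they enter here but not in \<open>loop_at\<close>.\<close>

definition coloop_at :: "'a set \<Rightarrow> 'a set \<Rightarrow> 'a set \<Rightarrow> 'a \<Rightarrow> bool" where
  "coloop_at F K X e \<longleftrightarrow>
    r (insert e (K \<union> {a\<in>X. e < a} \<union> {a\<in>F. a < e})) \<noteq> r (K \<union> {a\<in>X. e < a} \<union> {a\<in>F. a < e})"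

text \<open>When \<open>e\<close> is the smallest element of \<open>C\<close>, the rest of
  \<open>C\<close> lies in the part of \<open>A\<close> above \<open>e\<close>, and the rank
  criterion for circuits applies to that part.\<close>

lemma Ext_eq_loops:
  assumes "A \<subseteq> E"
  shows "Ext E indep A = {e\<in>E - A. loop_at {} A e}"
proof -
  have "(\<exists>C. circuit E indep C \<and> C \<subseteq> A \<union> {e} \<and> smallest_in e C) \<longleftrightarrow> loop_at {} A e"
    if e: "e \<in> E - A" for e
  proof -
    have "C \<subseteq> A \<union> {e} \<and> smallest_in e C \<longleftrightarrow> C \<subseteq> insert e {a\<in>A. e < a} \<and> e \<in> C" for C
      using e unfolding smallest_in_def by (auto simp: less_le)
    then show ?thesis
      using circuit_through_iff_rank[of e "{a\<in>A. e < a}"] e assms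
      unfolding loop_at_def by auto
  qed
  then show ?thesis unfolding Ext_def by auto
qed

text \<open>The rest of the cocircuit lies in the part of \<open>E - A\<close> above
  \<open>e\<close>. The complement of that part and \<open>e\<close> consists of the elements of
  \<open>A\<close> above \<open>e\<close> and all elements of \<open>E\<close> below
  \<open>e\<close>, as in \<open>coloop_at\<close>.\<close>

lemma Int_act_eq_coloops:
  assumes "A \<subseteq> E"
  shows "Int_act E indep A = {e\<in>A. coloop_at E {} A e}"
proof -
  have "(\<exists>C. cocircuit E indep C \<and> C \<subseteq> (E - A) \<union> {e} \<and> smallest_in e C) \<longleftrightarrow> coloop_at E {} A e"
    if e: "e \<in> A" for e
  proof -
    let ?D = "{a\<in>E - A. e < a}"
    have "C \<subseteq> (E - A) \<union> {e} \<and> smallest_in e C \<longleftrightarrow> C \<subseteq> insert e ?D \<and> e \<in> C" for C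
      using e unfolding smallest_in_def by (auto simp: less_le)
    then have "(\<exists>C. cocircuit E indep C \<and> C \<subseteq> (E - A) \<union> {e} \<and> smallest_in e C) \<longleftrightarrow>
        (\<exists>C. cocircuit E indep C \<and> C \<subseteq> insert e ?D \<and> e \<in> C)"
      by simp
    also have "\<dots> \<longleftrightarrow> r (insert e ({a\<in>A. e < a} \<union> {a\<in>E. a < e})) \<noteq> r ({a\<in>A. e < a} \<union> {a\<in>E. a < e})"
      by (rule cocircuit_through_iff_rank) (use e assms in \<open>auto simp: not_less less_le\<close>)
    finally show ?thesis by (simp add: coloop_at_def)
  qed
  then show ?thesis unfolding Int_act_def by auto
qed

section \<open>Counting loops and coloops, largest element first\<close>

lemma loop_at_insert_top:
  assumes "\<And>a. a \<in> F \<Longrightarrow> a < b" "e \<in> F"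
  shows "loop_at K (insert b X) e = loop_at (insert b K) X e"
proof -
  have "K \<union> {a \<in> insert b X. e < a} = insert b K \<union> {a \<in> X. e < a}"
    using assms by auto
  then show ?thesis by (simp only: loop_at_def)
qed

lemma coloop_at_insert_top:
  assumes "\<And>a. a \<in> F \<Longrightarrow> a < b" "e \<in> F"
  shows "coloop_at G K (insert b X) e = coloop_at G (insert b K) X e"
proof -
  have "K \<union> {a \<in> insert b X. e < a} = insert b K \<union> {a \<in> X. e < a}"
    using assms by auto
  then show ?thesis by (simp only: coloop_at_def)
qed

lemma coloop_at_insert_ground:
  assumes "\<And>a. a \<in> F \<Longrightarrow> a < b" "e \<in> F"
  shows "coloop_at (insert b F) K X e = coloop_at F K X e"
proof -
  have "{a \<in> insert b F. a < e} = {a \<in> F. a < e}" using assms by (auto simp: less_not_sym)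
  then show ?thesis by (simp only: coloop_at_def)
qed

lemma loop_at_top:
  assumes "\<And>a. a \<in> F \<Longrightarrow> a < b" "X \<subseteq> insert b F"
  shows "loop_at K X b \<longleftrightarrow> r (insert b K) = r K"
proof -
  have "{a\<in>X. b < a} = {}" using assms by (auto simp: less_not_sym)
  then show ?thesis unfolding loop_at_def by (simp only: Un_empty_right)
qed

lemma coloop_at_top:
  assumes "\<And>a. a \<in> F \<Longrightarrow> a < b" "X \<subseteq> insert b F"
  shows "coloop_at (insert b F) K X b \<longleftrightarrow> r (insert b (K \<union> F)) \<noteq> r (K \<union> F)"
proof -
  have "{a\<in>X. b < a} = {}" "{a \<in> insert b F. a < b} = F" using assms by (auto simp: less_not_sym)
  then show ?thesis unfolding coloop_at_def by (simp only: Un_empty_right)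
qed

text \<open>Induction on the largest element \<open>b\<close>: inside \<open>X\<close> it moves to
  \<open>K\<close>; outside \<open>X\<close> it raises the rank of \<open>K \<union> F\<close> by
  one exactly when it is a coloop.\<close>

lemma rank_eq_add_coloops:
  assumes "finite F"
  shows "X \<subseteq> F \<Longrightarrow> r (K \<union> F) = r (K \<union> X) + card {e\<in>F - X. coloop_at F K X e}"
  using assms
proof (induction F arbitrary: K X rule: finite_linorder_max_induct)
  case empty
  then show ?case by simp
next
  case (insert b F)
  have bF: "b \<notin> F" using insert by auto
  show ?case
  proof (cases "b \<in> X")
    case True
    define X' where "X' = X - {b}"
    have X: "X = insert b X'" "X' \<subseteq> F" "b \<notin> X'" using True insert by (auto simp: X'_def)
    have "{e\<in>insert b F - X. coloop_at (insert b F) K X e} = {e\<in>F - X'. coloop_at F (insert b K) X' e}"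
      using X bF coloop_at_insert_ground[of F b] coloop_at_insert_top[of F b] insert(2) by auto
    then show ?thesis using insert.IH[OF X(2), of "insert b K"] X by simp
  next
    case False
    then have X: "X \<subseteq> F" using insert by auto
    let ?P = "r (insert b (K \<union> F)) \<noteq> r (K \<union> F)"
    have "{e\<in>insert b F - X. coloop_at (insert b F) K X e} =
        (if ?P then {b} else {}) \<union> {e\<in>F - X. coloop_at F K X e}"
      using False bF coloop_at_insert_ground[of F b] coloop_at_top[of F b X K] insert(2) insert.prems
      by auto
    moreover have "b \<notin> {e\<in>F - X. coloop_at F K X e}" using bF by auto
    ultimately show ?thesis
      using insert.IH[OF X, of K] rank_insert_cases[of b "K \<union> F"] insert(1) by auto
  qed
qed

text \<open>Adding \<open>X\<close> to \<open>K\<close> from the largest element down, each step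
  raises the rank by one unless the new element is a loop of the current minor.\<close>

lemma rank_add_loops:
  assumes "finite F"
  shows "X \<subseteq> F \<Longrightarrow> K \<inter> F = {} \<Longrightarrow> r (K \<union> X) + card {e\<in>X. loop_at K X e} = r K + card X"
  using assms
proof (induction F arbitrary: K X rule: finite_linorder_max_induct)
  case empty
  then show ?case by simp
next
  case (insert b F)
  have bF: "b \<notin> F" using insert by auto
  show ?case
  proof (cases "b \<in> X")
    case True
    define X' where "X' = X - {b}"
    have X: "X = insert b X'" "X' \<subseteq> F" "b \<notin> X'" using True insert by (auto simp: X'_def)
    have fin: "finite X'" using X insert(1) finite_subset by blast
    let ?P = "r (insert b K) = r K"
    have "{e\<in>X. loop_at K X e} = (if ?P then {b} else {}) \<union> {e\<in>X'. loop_at (insert b K) X' e}"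
      using X loop_at_insert_top[of F b] loop_at_top[of F b X K] insert(2) insert.prems by auto
    moreover have "insert b K \<inter> F = {}" using insert.prems bF by auto
    ultimately show ?thesis
      using insert.IH[OF X(2), of "insert b K"] rank_insert_cases[of b K] X fin by auto
  next
    case False
    then show ?thesis using insert by auto
  qed
qed

lemma corank_eq_coloops: "A \<subseteq> E \<Longrightarrow> corank E indep A = card {e\<in>E - A. coloop_at E {} A e}"
  using rank_eq_add_coloops[OF finite_ground, of A "{}"] by (simp add: corank_def)

lemma nullity_eq_loops: "A \<subseteq> E \<Longrightarrow> nullity indep A = card {e\<in>A. loop_at {} A e}"
  using rank_add_loops[OF finite_ground, of A "{}"] by (simp add: nullity_def rank_empty)

section \<open>Deletion-contraction\<close>

text \<open>Over \<open>F = E\<close> with \<open>K = {}\<close>, the product of these factors is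
  the monomial recording internal activity (\<open>x\<close>), external activity (\<open>y\<close>),
  corank (\<open>u\<close>) and nullity (\<open>v\<close>) of \<open>X\<close>.\<close>

definition weight :: "'r::comm_ring_1 \<Rightarrow> 'r \<Rightarrow> 'r \<Rightarrow> 'r \<Rightarrow> 'a set \<Rightarrow> 'a set \<Rightarrow> 'a set \<Rightarrow> 'a \<Rightarrow> 'r" where
  "weight x y u v F K X e =
    (if loop_at K X e then (if e \<in> X then v else y) else 1) *
    (if coloop_at F K X e then (if e \<in> X then x else u) else 1)"

definition weight_sum :: "'r::comm_ring_1 \<Rightarrow> 'r \<Rightarrow> 'r \<Rightarrow> 'r \<Rightarrow> 'a set \<Rightarrow> 'a set \<Rightarrow> 'r" where
  "weight_sum x y u v F K = (\<Sum>X\<in>Pow F. \<Prod>e\<in>F. weight x y u v F K X e)"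

text \<open>Nothing lies above \<open>b\<close>, so its loop and coloop status is the same for every
  \<open>X\<close>. The sets without \<open>b\<close> give the deletion term, those with
  \<open>b\<close> the contraction term.\<close>

lemma weight_sum_insert:
  fixes K :: "'a set"
  assumes fin: "finite F" and top: "\<And>a. a \<in> F \<Longrightarrow> a < b"
  defines "l \<equiv> r (insert b K) = r K" and "c \<equiv> r (insert b (K \<union> F)) \<noteq> r (K \<union> F)"
  shows "weight_sum x y u v (insert b F) K =
    (if l then y else 1) * (if c then u else 1) * weight_sum x y u v F K +
    (if l then v else 1) * (if c then x else 1) * weight_sum x y u v F (insert b K)"
proof -
  have bF: "b \<notin> F" using top by auto
  let ?w = "weight x y u v"
  have out: "(\<Prod>e\<in>insert b F. ?w (insert b F) K X e) =
      (if l then y else 1) * (if c then u else 1) * (\<Prod>e\<in>F. ?w F K X e)" if "X \<subseteq> F" for X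
  proof -
    have "?w (insert b F) K X b = (if l then y else 1) * (if c then u else 1)"
      using that bF loop_at_top[of F b X K] coloop_at_top[of F b X K] top
      by (auto simp: weight_def l_def c_def)
    moreover have "?w (insert b F) K X e = ?w F K X e" if "e \<in> F" for e
      using that top by (simp add: weight_def coloop_at_insert_ground[of F b])
    ultimately show ?thesis using fin bF by simp
  qed
  have inn: "(\<Prod>e\<in>insert b F. ?w (insert b F) K (insert b X) e) =
      (if l then v else 1) * (if c then x else 1) * (\<Prod>e\<in>F. ?w F (insert b K) X e)" if "X \<subseteq> F" for X
  proof -
    have "insert b X \<subseteq> insert b F" using that by auto
    then have "?w (insert b F) K (insert b X) b = (if l then v else 1) * (if c then x else 1)"
      using loop_at_top[of F b "insert b X" K] coloop_at_top[of F b "insert b X" K] top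
      by (auto simp: weight_def l_def c_def)
    moreover have "?w (insert b F) K (insert b X) e = ?w F (insert b K) X e" if "e \<in> F" for e
      using that top bF
      by (auto simp: weight_def coloop_at_insert_ground[of F b] coloop_at_insert_top[of F b]
          loop_at_insert_top[of F b])
    ultimately show ?thesis using fin bF by simp
  qed
  have "inj_on (insert b) (Pow F)" using bF by (auto simp: inj_on_def)
  moreover have "Pow F \<inter> insert b ` Pow F = {}" using bF by auto
  ultimately show ?thesis
    using fin
    by (simp add: weight_sum_def Pow_insert sum.union_disjoint sum.reindex out inn sum_distrib_left)
qed

text \<open>The hypothesis says that \<open>b\<close> is a loop or a coloop of the minor.\<close>

lemma weight_sum_contract_eq_delete:
  assumes "\<And>Z. K \<subseteq> Z \<Longrightarrow> Z \<subseteq> K \<union> F \<Longrightarrow> r (insert b Z) = r Z + d"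
  shows "weight_sum x y u v F (insert b K) = weight_sum x y u v F K"
proof -
  have "weight x y u v F (insert b K) X e = weight x y u v F K X e" if "X \<subseteq> F" "e \<in> F" for X e
  proof -
    \<comment> \<open>Both ranks compared in \<open>loop_at\<close> and \<open>coloop_at\<close>
      shift by the same \<open>d\<close>, so the comparisons keep their outcome.\<close>
    have "r (insert e (insert b Z)) = r (insert e Z) + d \<and> r (insert b Z) = r Z + d"
      if "K \<subseteq> Z" "Z \<subseteq> K \<union> F" for Z
      using assms[of Z] assms[of "insert e Z"] that \<open>e \<in> F\<close> by (auto simp: insert_commute)
    from this[of "K \<union> {a\<in>X. e < a}"] this[of "K \<union> {a\<in>X. e < a} \<union> {a\<in>F. a < e}"] \<open>X \<subseteq> F\<close>
    have "loop_at (insert b K) X e = loop_at K X e" "coloop_at F (insert b K) X e = coloop_at F K X e"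
      unfolding loop_at_def coloop_at_def Un_insert_left by fastforce+
    then show ?thesis by (simp add: weight_def)
  qed
  then show ?thesis unfolding weight_sum_def by (intro sum.cong prod.cong) auto
qed

text \<open>The largest element splits off a factor \<open>y + v\<close> if it is a loop and
  \<open>x + u\<close> if it is a coloop. Otherwise both terms of deletion-contraction have
  coefficient 1.\<close>

lemma weight_sum_cong:
  fixes x y u v :: "'r::comm_ring_1"
  assumes "finite F" and xu: "x + u = x' + u'" and yv: "y + v = y' + v'"
  shows "K \<inter> F = {} \<Longrightarrow> weight_sum x y u v F K = weight_sum x' y' u' v' F K"
  using assms(1)
proof (induction F arbitrary: K rule: finite_linorder_max_induct)
  case empty
  then show ?case by (simp add: weight_sum_def)
next
  case (insert b F)
  have bF: "b \<notin> F" using insert by auto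
  have IH: "weight_sum x y u v F K = weight_sum x' y' u' v' F K"
      "weight_sum x y u v F (insert b K) = weight_sum x' y' u' v' F (insert b K)"
    using insert.IH[of K] insert.IH[of "insert b K"] insert.prems bF by auto
  note expand = weight_sum_insert[OF insert(1), of b] insert(2)
  consider (loop) "r (insert b K) = r K" | (coloop) "r (insert b (K \<union> F)) \<noteq> r (K \<union> F)"
    | (neither) "r (insert b K) \<noteq> r K" "r (insert b (K \<union> F)) = r (K \<union> F)" by blast
  then show ?case
  proof cases
    case loop
    \<comment> \<open>A loop stays in the closure of every larger set; taking
      \<open>K \<union> F\<close> shows that \<open>b\<close> is not also a coloop.\<close>
    have span: "r (insert b Z) = r Z + 0" if "K \<subseteq> Z" for Z
      using rank_insert_eq_superset[OF loop that] by simp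
    have "weight_sum x y u v (insert b F) K = (y + v) * weight_sum x y u v F K" for x y u v :: 'r
      using span[of "K \<union> F"] loop
      by (simp add: expand distrib_right weight_sum_contract_eq_delete[of K F b 0, OF span])
    then show ?thesis using yv IH by simp
  next
    case coloop
    \<comment> \<open>If \<open>b\<close> failed to raise the rank of \<open>Z\<close>, it would
      fail for the larger set \<open>K \<union> F\<close>.\<close>
    have span: "r (insert b Z) = r Z + 1" if "K \<subseteq> Z" "Z \<subseteq> K \<union> F" for Z
      using rank_insert_eq_superset[OF _ that(2), of b] rank_insert_cases[of b Z] coloop by auto
    have "weight_sum x y u v (insert b F) K = (x + u) * weight_sum x y u v F K" for x y u v :: 'r
      using span[of K] coloop
      by (simp add: expand distrib_right weight_sum_contract_eq_delete[of K F b 1, OF span])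
    then show ?thesis using xu IH by simp
  next
    case neither
    then show ?thesis using IH by (simp add: expand)
  qed
qed

section \<open>The expansion in four parameters and its coefficients\<close>

lemma weight_sum_eq:
  "weight_sum x y u v E {} =
    (\<Sum>A\<in>Pow E. x ^ int_activity E indep A * y ^ ext_activity E indep A
      * u ^ corank E indep A * v ^ nullity indep A)"
proof -
  have pow: "(\<Prod>e\<in>E. if P e then z else 1) = z ^ card {e\<in>E. P e}" for P and z :: 'b
    using finite_ground by (simp add: prod.If_cases Int_def)
  have "(\<Prod>e\<in>E. weight x y u v E {} A e) = x ^ int_activity E indep A * y ^ ext_activity E indep A
      * u ^ corank E indep A * v ^ nullity indep A" if A: "A \<subseteq> E" for A
  proof -
    have "weight x y u v E {} A e =
        (if e \<in> A \<and> coloop_at E {} A e then x else 1) * (if e \<notin> A \<and> loop_at {} A e then y else 1)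
        * (if e \<notin> A \<and> coloop_at E {} A e then u else 1) * (if e \<in> A \<and> loop_at {} A e then v else 1)"
      for e by (simp add: weight_def mult.commute)
    moreover have "{e\<in>E. e \<in> A \<and> P e} = {e\<in>A. P e}" "{e\<in>E. e \<notin> A \<and> P e} = {e\<in>E - A. P e}" for P
      using A by auto
    ultimately show ?thesis
      using A by (simp add: prod.distrib pow int_activity_def ext_activity_def Int_act_eq_coloops
          Ext_eq_loops corank_eq_coloops nullity_eq_loops)
  qed
  then show ?thesis unfolding weight_sum_def by (intro sum.cong) auto
qed

text \<open>On the left the activity parameters are set to 1, so only corank and nullity remain; the
  sums \<open>1 + (u + (x - 1)) = x + u\<close> and \<open>1 + (v + (y - 1)) = y + v\<close>
  agree.\<close>

theorem corank_nullity_activity_expansion: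
  fixes x y u v :: "'r::comm_ring_1"
  shows "(\<Sum>A\<in>Pow E. (u + (x - 1)) ^ corank E indep A * (v + (y - 1)) ^ nullity indep A) =
    (\<Sum>A\<in>Pow E. x ^ int_activity E indep A * y ^ ext_activity E indep A
      * u ^ corank E indep A * v ^ nullity indep A)"
  using weight_sum_cong[OF finite_ground, of 1 "u + (x - 1)" x u 1 "v + (y - 1)" y v "{}"]
  by (simp add: weight_sum_eq)

text \<open>Compare the coefficients of \<open>u ^ p * v ^ q\<close> in the preceding identity, with
  \<open>x\<close> and \<open>y\<close> as constants. The left side is the derivative of the Tutte
  polynomial with \<open>p! q!\<close> divided out.\<close>

lemma binomial_activity_expansion:
  fixes x y :: "'r::idom"
  shows "(\<Sum>A\<in>Pow E. of_nat (corank E indep A choose p) * (x - 1) ^ (corank E indep A - p)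
      * (of_nat (nullity indep A choose q) * (y - 1) ^ (nullity indep A - q))) =
    (\<Sum>A | A \<subseteq> E \<and> corank E indep A = p \<and> nullity indep A = q.
      x ^ int_activity E indep A * y ^ ext_activity E indep A)"
proof -
  \<comment> \<open>For \<open>k > n\<close> both sides vanish, so the truncated exponent does no
    harm.\<close>
  have binom: "coeff ([:a, 1:] ^ n) k = of_nat (n choose k) * a ^ (n - k)" for a :: "'s::idom" and n k
  proof (cases "k \<le> n")
    case True
    then show ?thesis by (simp add: coeff_linear_poly_power)
  next
    case False
    then show ?thesis by (simp add: coeff_eq_0 degree_linear_power binomial_eq_0)
  qed
  \<comment> \<open>\<open>?v\<close> is the outer variable and \<open>?u\<close> the inner one,
    hence the order of \<open>q\<close> and \<open>p\<close>; \<open>?c\<close> embeds the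
    constants.\<close>
  let ?co = "\<lambda>P :: 'r poly poly. coeff (coeff P q) p"
  let ?c = "\<lambda>a :: 'r. [:[:a:]:]"
  let ?u = "[:[:0, 1:]:] :: 'r poly poly" and ?v = "[:0, 1:] :: 'r poly poly"
  have "?co ((?u + (?c x - 1)) ^ m * (?v + (?c y - 1)) ^ n) =
      of_nat (m choose p) * (x - 1) ^ (m - p) * (of_nat (n choose q) * (y - 1) ^ (n - q))" for m n
  proof -
    have "?u + (?c x - 1) = [:[:x - 1, 1:]:]" "?v + (?c y - 1) = [:[:y - 1:], 1:]"
      by (simp_all add: one_pCons)
    then show ?thesis
      by (simp add: poly_const_pow binom of_nat_poly mult_ac)
  qed
  moreover have "?co (?c x ^ i * ?c y ^ j * ?u ^ m * ?v ^ n) =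
      (if m = p \<and> n = q then x ^ i * y ^ j else 0)" for i j m n
  proof -
    have "?c x ^ i * ?c y ^ j * ?u ^ m * ?v ^ n = monom (monom (x ^ i * y ^ j) m) n"
      by (simp add: poly_const_pow monom_altdef smult_monom)
    then show ?thesis by simp
  qed
  ultimately show ?thesis
    using arg_cong[OF corank_nullity_activity_expansion[of ?u "?c x" ?v "?c y"], of ?co] finite_ground
    by (simp add: coeff_sum sum.If_cases Collect_conj_eq Pow_def Int_assoc)
qed

end

section \<open>Derivatives\<close>

text \<open>Stated for an abstract derivation to serve both partial derivatives; \<open>c\<close>
  stands for the factor in the other variable. The falling factorial is written with a binomial to
  match the coefficient comparison.\<close>

lemma funpow_derivation_power:
  fixes D :: "'r::comm_ring_1 \<Rightarrow> 'r"
  assumes add: "\<And>a b. D (a + b) = D a + D b" and mult: "\<And>a b. D (a * b) = a * D b + D a * b"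
    and "D z = 1" "D c = 0"
  shows "(D ^^ p) (z ^ n * c) = of_nat (fact p * (n choose p)) * z ^ (n - p) * c"
proof (induction p)
  case 0
  then show ?case by simp
next
  case (Suc p)
  have "D 1 = 0" using mult[of 1 1] by simp
  moreover have "D 0 = 0" using add[of 0 0] by simp
  ultimately have of_nat: "D (of_nat k) = 0" for k
    by (induction k) (simp_all add: add)
  have power: "D (z ^ k) = of_nat k * z ^ (k - 1)" for k
  proof (induction k)
    case (Suc k)
    then show ?case using \<open>D z = 1\<close> by (cases k) (simp_all add: mult algebra_simps)
  qed (simp add: \<open>D 1 = 0\<close>)
  \<comment> \<open>Absorption gives
    \<open>(n - p) * (n choose p) = Suc p * (n choose Suc p)\<close>; for \<open>p \<ge> n\<close>
    both sides are 0.\<close>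
  have "fact p * (n choose p) * (n - p) = (fact (Suc p) * (n choose Suc p) :: nat)"
    by (simp only: fact_Suc of_nat_id mult.assoc mult.left_commute[of "Suc p" "fact p"]
        binomial_absorption mult.commute[of "n choose p"] binomial_absorb_comp)
  then have "of_nat (fact p * (n choose p)) * of_nat (n - p) =
      (of_nat (fact (Suc p) * (n choose Suc p)) :: 'r)"
    by (metis of_nat_mult)
  then show ?case
    using Suc \<open>D c = 0\<close>
    by (simp del: fact_Suc of_nat_mult add: mult of_nat power mult.assoc[symmetric])
qed

lemma funpow_sum:
  fixes D :: "'r::comm_ring_1 \<Rightarrow> 'r"
  assumes "\<And>a b. D (a + b) = D a + D b"
  shows "(D ^^ p) (sum f A) = (\<Sum>i\<in>A. (D ^^ p) (f i))"
proof (induction p)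
  case (Suc p)
  have "D 0 = 0" using assms[of 0 0] by simp
  then show ?case using Suc sum_comp_morphism[of D "\<lambda>i. (D ^^ p) (f i)" A] assms by (simp add: o_def)
qed simp

lemma partial_y_add: "partial_y (a + b) = partial_y a + partial_y b"
  by (simp add: partial_y_def pderiv_add)

lemma partial_y_mult: "partial_y (a * b) = a * partial_y b + partial_y a * b"
  by (simp add: partial_y_def pderiv_mult)

lemma coeff_partial_x: "coeff (partial_x a) n = pderiv (coeff a n)"
  by (simp add: partial_x_def coeff_map_poly)

lemma partial_x_add: "partial_x (a + b) = partial_x a + partial_x b"
  by (rule poly_eqI) (simp add: coeff_partial_x pderiv_add)

text \<open>Each coefficient in \<open>y\<close> of a product is a convolution of polynomials in
  \<open>x\<close>, to which the ordinary product rule applies termwise.\<close>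

lemma partial_x_mult: "partial_x (a * b) = a * partial_x b + partial_x a * b"
  by (rule poly_eqI)
    (simp add: coeff_partial_x coeff_mult higher_pderiv_sum[of 1, simplified] pderiv_mult sum.distrib
      mult.commute[of "pderiv _"])

lemma partial_xy_power:
  "(partial_x ^^ p) ((partial_y ^^ q) ((var_x - 1) ^ m * (var_y - 1) ^ n)) =
    fact p * fact q *
    (of_nat (m choose p) * (var_x - 1) ^ (m - p) * (of_nat (n choose q) * (var_y - 1) ^ (n - q)))"
proof -
  have x: "partial_x (var_x - 1) = 1" "partial_y (var_x - 1) = 0"
    by (simp_all add: var_x_def partial_x_def partial_y_def one_pCons map_poly_pCons pderiv_pCons)
  have y: "partial_y (var_y - 1) = 1" "partial_x (var_y - 1) = 0"
    by (simp_all add: var_y_def partial_x_def partial_y_def one_pCons map_poly_pCons pderiv_pCons)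
  have zero: "D (c ^ k) = 0" if "\<And>a b. D (a * b) = a * D b + D a * b" "D c = 0"
    for D :: "bipoly \<Rightarrow> bipoly" and c k
  proof (induction k)
    case 0
    then show ?case using that(1)[of 1 1] by simp
  next
    case (Suc k)
    then show ?case using that by simp
  qed
  have "partial_x (of_nat k) = 0" for k
    by (simp add: partial_x_def of_nat_poly map_poly_pCons pderiv_of_nat)
  \<comment> \<open>What the \<open>y\<close>-derivative leaves of the second factor is free of
    \<open>x\<close> and acts as the constant for \<open>partial_x\<close>.\<close>
  then have 1: "partial_x (of_nat k * (var_y - 1) ^ j) = 0" for k j
    by (simp add: partial_x_mult zero[OF partial_x_mult y(2)])
  have "(partial_y ^^ q) ((var_x - 1) ^ m * (var_y - 1) ^ n) =
      (var_x - 1) ^ m * (of_nat (fact q * (n choose q)) * (var_y - 1) ^ (n - q))"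
    using funpow_derivation_power[OF partial_y_add partial_y_mult y(1) zero[OF partial_y_mult x(2)], of q n m]
    by (simp add: mult_ac)
  then show ?thesis
    using funpow_derivation_power[OF partial_x_add partial_x_mult x(1) 1, of p m
        "fact q * (n choose q)" "n - q"]
    by (simp add: mult_ac)
qed

theorem theorem1:
  fixes E :: "'a::linorder set" and indep :: "'a set \<Rightarrow> bool" and p q :: nat
  assumes "matroid E indep"
  shows "(partial_x ^^ p) ((partial_y ^^ q) (tutte E indep)) =
    fact p * fact q *
      (\<Sum>A | A \<subseteq> E \<and> corank E indep A = p \<and> nullity indep A = q.
         var_x ^ int_activity E indep A * var_y ^ ext_activity E indep A)"
proof -
  interpret ordered_matroid E indep
    using assms by (simp add: ordered_matroid_def)
  \<comment> \<open>Termwise differentiation yields \<open>p! q!\<close> times the binomial sum,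
    taken in the ring \<open>bipoly\<close> at \<open>var_x\<close> and
    \<open>var_y\<close>.\<close>
  show ?thesis
    by (simp only: tutte_def funpow_sum partial_x_add partial_y_add partial_xy_power
        sum_distrib_left[symmetric] binomial_activity_expansion)
qed

end
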